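(* Let $\ell\ge1$ and let $P(\lambda)=\sum_{i=0}^dP_i\lambda^i\in\mathbb F[\lambda]^{m\times n}$ be a matrix polynomial with grade $d=k\ell$, for some integer $k$, with $\ell<d$. Let $\epsilon,\eta\ge 0$ be integers with $\epsilon+\eta+1=k$. Define the grade-$\ell$ matrix polynomials $$B_1(\lambda):=P_\ell\lambda^\ell+P_{\ell-1}\lambda^{\ell-1}+\cdots+P_1\lambda+P_0,$$ $$B_j(\lambda):=P_{\ell j}\lambda^\ell+P_{\ell j-1}\lambda^{\ell-1}+\cdots+P_{\ell(j-1)+1}\lambda,\qquad j=2,\dots,k,$$ and let $$\Sigma_P^{(\epsilon,\eta)}(\lambda):=\begin{bmatrix}B_k(\lambda)&B_{k-1}(\lambda)&\cdots&B_{\eta+1}(\lambda)\\0&\cdots&0&\vdots\\\vdots&\ddots&\vdots&B_2(\lambda)\\0&\cdots&0&B_1(\lambda)\end{bmatrix},$$ i.e. the $(\eta+1)\times(\epsilon+1)$ block matrix whose first block row is $B_k,B_{k-1},\dots,B_{\eta+1}$, whose last block column is $B_{\eta+1},B_\eta,\dots,B_1$, and whose other blocks are zero. Then the block Kronecker matrix polynomial $$\left[\begin{array}{c|c}\Sigma_P^{(\epsilon,\eta)}(\lambda)&L_\eta(\lambda^\ell)^T\otimes I_m\\\hline L_\epsilon(\lambda^\ell)\otimes I_n&0\end{array}\right]$$ is a companion $\ell$-ification (or a companion form of degree $\ell$) for $m\times n$ matrix polynomials of grade $d$.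
   Context: $\mathbb F$ is an arbitrary field. A matrix polynomial has grade $d$ if written $\sum_{i=0}^dP_i\lambda^i$, with any coefficient (including $P_d$) possibly zero; the degree is the largest $i$ with nonzero coefficient. $\mathrm{rev}_dP(\lambda):=\lambda^dP(\lambda^{-1})$ (considered with grade $d$). A square matrix polynomial is unimodular if its determinant is a nonzero constant. $L_k(\lambda)\in\mathbb F[\lambda]^{k\times(k+1)}$ is the bidiagonal pencil with $(i,i)$ entries $-1$, $(i,i+1)$ entries $\lambda$, and all other entries $0$; $L_\epsilon(\lambda^\ell)$ means $L_\epsilon$ evaluated at $\lambda^\ell$. If $\epsilon=0$ (resp. $\eta=0$) the corresponding block row (resp. block column) is absent. $\otimes$ is the Kronecker product. A matrix polynomial $L(\lambda)$ of degree $\ell>0$ is an $\ell$-ification of $P(\lambda)$ of grade $d$ if for some $s\ge0$ there are unimodular $U(\lambda),V(\lambda)$ with $U(\lambda)L(\lambda)V(\lambda)=\begin{bmatrix}I_s&0\\0&P(\lambda)\end{bmatrix}$; it is a strong $\ell$-ification if, additionally, $\mathrm{rev}_\ell L(\lambda)$ is an $\ell$-ification of $\mathrm{rev}_dP(\lambda)$. A companion $\ell$-ification (companion form of degree $\ell$) for $m\times n$ matrix polynomials of grade $d$ is a uniform template for constructing, from the coefficients of $P(\lambda)=\sum_{i=0}^dP_i\lambda^i$, a matrix polynomial $L(\lambda)=\sum_{i=0}^\ell L_i\lambda^i$ of degree $\ell$ such that $L(\lambda)$ is a strong $\ell$-ification of $P(\lambda)$ for every $m\times n$ matrix polynomial $P(\lambda)$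 of grade $d$ and, for $i=0,\dots,\ell$, each entry of $L_i$ is a scalar-valued function of the entries of $P_0,\dots,P_d$ which is either a constant or a constant multiple of just one of the entries of $P_0,\dots,P_d$. *)

theory Defs
  imports "Jordan_Normal_Form.Determinant" "HOL-Computational_Algebra.Polynomial"
begin

text \<open>
  A matrix polynomial is a matrix with polynomial entries (type \<^typ>\<open>'a poly mat\<close>).
  The matrix type admits zero rows or columns, which is how absent block rows and
  block columns are represented.
\<close>

definition mat_coeff :: "'a::zero poly mat \<Rightarrow> nat \<Rightarrow> 'a mat" where
  "mat_coeff P i = map_mat (\<lambda>p. coeff p i) P"

definition has_grade :: "nat \<Rightarrow> 'a::zero poly mat \<Rightarrow> bool" where
  "has_grade d P \<longleftrightarrow> (\<forall>i>d. mat_coeff P i = 0\<^sub>m (dim_row P) (dim_col P))"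

definition has_degree :: "nat \<Rightarrow> 'a::zero poly mat \<Rightarrow> bool" where
  "has_degree d P \<longleftrightarrow> has_grade d P \<and> mat_coeff P d \<noteq> 0\<^sub>m (dim_row P) (dim_col P)"

text \<open>
  For \<open>P\<close> of grade \<open>d\<close> this is \<open>\<lambda>\<^sup>d P(\<lambda>\<^sup>-\<^sup>1)\<close>. Unlike \<^const>\<open>reflect_poly\<close>, the reversal
  is taken with respect to the grade and not to the degrees of the entries.
\<close>

definition mat_rev :: "nat \<Rightarrow> 'a::comm_monoid_add poly mat \<Rightarrow> 'a poly mat" where
  "mat_rev d P = map_mat (\<lambda>p. \<Sum>i\<le>d. monom (coeff p i) (d - i)) P"

definition unimodular :: "'a::field poly mat \<Rightarrow> bool" where
  "unimodular U \<longleftrightarrow> square_mat U \<and> (\<exists>c. c \<noteq> 0 \<and> det U = [:c:])"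

definition ell_ification :: "nat \<Rightarrow> 'a::field poly mat \<Rightarrow> nat \<Rightarrow> 'a poly mat \<Rightarrow> bool" where
  "ell_ification l L d P \<longleftrightarrow>
     l > 0 \<and> has_degree l L \<and> has_grade d P \<and>
     (\<exists>s U V.
        U \<in> carrier_mat (dim_row L) (dim_row L) \<and> unimodular U \<and>
        V \<in> carrier_mat (dim_col L) (dim_col L) \<and> unimodular V \<and>
        U * L * V =
          four_block_mat (1\<^sub>m s) (0\<^sub>m s (dim_col P))
                         (0\<^sub>m (dim_row P) s) P)"

definition strong_ell_ification :: "nat \<Rightarrow> 'a::field poly mat \<Rightarrow> nat \<Rightarrow> 'a poly mat \<Rightarrow> bool" where
  "strong_ell_ification l L d P \<longleftrightarrow>
     ell_ification l L d P \<and> ell_ification l (mat_rev l L) d (mat_rev d P)"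

text \<open>
  A template is a map \<open>T\<close> from matrix polynomials (equivalently, when the grade is \<open>d\<close>, from
  coefficient tuples \<open>P\<^sub>0, \<dots>, P\<^sub>d\<close>) to matrix polynomials. Uniformity means that the size
  \<open>p \<times> q\<close>, and, for each entry of each coefficient, the constant or the selected entry
  \<open>(P\<^sub>j)\<^sub>a\<^sub>b\<close> and its multiplier, do not depend on \<open>P\<close>.
\<close>

definition companion_ell_ification ::
  "nat \<Rightarrow> nat \<Rightarrow> nat \<Rightarrow> nat \<Rightarrow> ('a::field poly mat \<Rightarrow> 'a poly mat) \<Rightarrow> bool" where
  "companion_ell_ification l d m n T \<longleftrightarrow>
     (\<exists>p q.
        (\<forall>P \<in> carrier_mat m n. has_grade d P \<longrightarrow>
           T P \<in> carrier_mat p q \<and> strong_ell_ification l (T P) d P) \<and>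
        (\<forall>i\<le>l. \<forall>r<p. \<forall>c<q.
           (\<exists>x. \<forall>P \<in> carrier_mat m n. has_grade d P \<longrightarrow>
              mat_coeff (T P) i $$ (r, c) = x) \<or>
           (\<exists>x. \<exists>j\<le>d. \<exists>a<m. \<exists>b<n. \<forall>P \<in> carrier_mat m n. has_grade d P \<longrightarrow>
              mat_coeff (T P) i $$ (r, c) = x * mat_coeff P j $$ (a, b))))"

definition kronecker :: "'a::times mat \<Rightarrow> 'a mat \<Rightarrow> 'a mat" where
  "kronecker A B =
     mat (dim_row A * dim_row B) (dim_col A * dim_col B)
       (\<lambda>(r, c). A $$ (r div dim_row B, c div dim_col B) * B $$ (r mod dim_row B, c mod dim_col B))"

definition L_pencil :: "nat \<Rightarrow> 'a::comm_ring_1 poly mat" where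
  "L_pencil k = mat k (k + 1)
     (\<lambda>(i, j). if j = i then - 1 else if j = i + 1 then [:0, 1:] else 0)"

definition subst_power :: "nat \<Rightarrow> 'a::comm_ring_1 poly mat \<Rightarrow> 'a poly mat" where
  "subst_power l A = map_mat (\<lambda>p. p \<circ>\<^sub>p monom 1 l) A"

text \<open>
  \<open>B_block l P j\<close> is \<open>B\<^sub>j\<close> for \<open>j \<ge> 1\<close>: the coefficient of \<open>\<lambda>\<^sup>i\<close> is \<open>P\<^bsub>l(j-1)+i\<^esub>\<close>, and the
  constant term is present only for \<open>j = 1\<close>.
\<close>

definition B_block :: "nat \<Rightarrow> 'a::comm_ring_1 poly mat \<Rightarrow> nat \<Rightarrow> 'a poly mat" where
  "B_block l P j = mat (dim_row P) (dim_col P)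
     (\<lambda>(a, b). \<Sum>i = (if j = 1 then 0 else 1)..l.
        monom (mat_coeff P (l * (j - 1) + i) $$ (a, b)) i)"

text \<open>
  Block rows and block columns are numbered from \<open>0\<close>, so the first block row is
  \<open>B\<^sub>k, \<dots>, B\<^bsub>eta+1\<^esub>\<close> with \<open>k = eps + eta + 1\<close>.
\<close>

definition Sigma_block ::
  "nat \<Rightarrow> nat \<Rightarrow> nat \<Rightarrow> 'a::comm_ring_1 poly mat \<Rightarrow> nat \<Rightarrow> nat \<Rightarrow> 'a poly mat" where
  "Sigma_block l eps eta P i j =
     (if i = 0 then B_block l P (eps + eta + 1 - j)
      else if j = eps then B_block l P (eta + 1 - i)
      else 0\<^sub>m (dim_row P) (dim_col P))"

definition Sigma_mat :: "nat \<Rightarrow> nat \<Rightarrow> nat \<Rightarrow> 'a::comm_ring_1 poly mat \<Rightarrow> 'a poly mat" where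
  "Sigma_mat l eps eta P =
     (let m = dim_row P; n = dim_col P in
      mat ((eta + 1) * m) ((eps + 1) * n)
        (\<lambda>(r, c). Sigma_block l eps eta P (r div m) (c div n) $$ (r mod m, c mod n)))"

definition block_kronecker_mat ::
  "nat \<Rightarrow> nat \<Rightarrow> nat \<Rightarrow> 'a::comm_ring_1 poly mat \<Rightarrow> 'a poly mat" where
  "block_kronecker_mat l eps eta P =
     (let m = dim_row P; n = dim_col P in
      four_block_mat
        (Sigma_mat l eps eta P)
        (kronecker (transpose_mat (subst_power l (L_pencil eta))) (1\<^sub>m m))
        (kronecker (subst_power l (L_pencil eps)) (1\<^sub>m n))
        (0\<^sub>m (eps * n) (eta * m)))"

end

theory Submission
  imports Defs
begin

text \<open>
  Write the matrix polynomial in question as \<open>M = [A C; D 0]\<close>. The blocks \<open>C\<close> and \<open>D\<close> are built from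
  the bidiagonal matrix with entries \<open>-y\<close> and \<open>x\<close>, where \<open>x = \<lambda>\<^sup>l\<close>, \<open>y = 1\<close>. Its null space is spanned
  by \<open>(x\<^sup>k, x\<^bsup>k-1\<^esup>y, \<dots>, y\<^sup>k)\<close>, and because \<open>x\<close> or \<open>y\<close> equals \<open>1\<close> this vector is the first column of a
  unimodular matrix that brings the bidiagonal matrix to the form \<open>[0 I]\<close>
  (\<open>bidiag_completion\<close>). Taking Kronecker products with identity matrices gives unimodular
  \<open>Q\<close> and \<open>V\<close> such that \<open>Q C = [0; I]\<close> and \<open>D V = [0 I]\<close>.

  After this transformation the two identity blocks clear everything in \<open>Q A V\<close> except its leading
  \<open>m \<times> n\<close> corner (\<open>equivalent_with_completions\<close>), so \<open>M\<close> is unimodularly equivalent to the direct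
  sum of an identity matrix and this corner. The corner is the double sum of the blocks of \<open>A\<close>
  weighted with the entries of the two null vectors (\<open>block_bidiag_equivalent\<close>). For
  \<open>A = \<Sigma>\<^sub>P\<close> only the first block row and the last block column contribute, and the sum is
  \<open>B\<^sub>1 + \<lambda>\<^sup>l B\<^sub>2 + \<dots> + \<lambda>\<^bsup>l(k-1)\<^esup> B\<^sub>k = P\<close> (\<open>sum_segment_hook\<close>).

  The reversal of \<open>M\<close> has the same shape with \<open>x = 1\<close>, \<open>y = \<lambda>\<^sup>l\<close>, and the corresponding sum is the
  reversal of the previous identity (\<open>sum_rev_segment_hook\<close>). The remaining conditions, on the
  degree and on the individual entries, are read off from the blocks.
\<close>

section \<open>Unimodular matrices\<close>

lemma mult_mat_entry:
  assumes "A \<in> carrier_mat nr n" "B \<in> carrier_mat n nc" "i < nr" "j < nc"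
  shows "(A * B) $$ (i, j) = (\<Sum>k<n. A $$ (i, k) * B $$ (k, j))"
  using assms by (auto simp: scalar_prod_def lessThan_atLeast0 intro!: sum.cong)

text \<open>
  A one-sided inverse over the polynomial ring makes the determinant a unit, that is, a nonzero
  constant; conversely the adjugate divided by the determinant is an inverse. Every matrix below is
  therefore shown to be unimodular by exhibiting an inverse instead of computing a determinant.
\<close>
lemma unimodular_iff_left_inverse:
  fixes U :: "'a::field poly mat"
  assumes U: "U \<in> carrier_mat n n"
  shows "unimodular U \<longleftrightarrow> (\<exists>W \<in> carrier_mat n n. W * U = 1\<^sub>m n)"
proof
  assume "unimodular U"
  then obtain c where c: "c \<noteq> 0" "det U = [:c:]"
    by (auto simp: unimodular_def)
  let ?W = "[:inverse c:] \<cdot>\<^sub>m adj_mat U"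
  have "?W * U = [:inverse c:] \<cdot>\<^sub>m (adj_mat U * U)"
    using adj_mat(1)[OF U] U by (simp add: mult_smult_assoc_mat[of _ n n _ n])
  also have "\<dots> = 1\<^sub>m n"
    unfolding adj_mat(3)[OF U] using c by (intro eq_matI) auto
  finally show "\<exists>W \<in> carrier_mat n n. W * U = 1\<^sub>m n"
    using adj_mat(1)[OF U] by (intro bexI[of _ ?W]) auto
next
  assume "\<exists>W \<in> carrier_mat n n. W * U = 1\<^sub>m n"
  then obtain W where W: "W \<in> carrier_mat n n" "W * U = 1\<^sub>m n" by blast
  have "det W * det U = 1"
    using det_mult[OF W(1) U] W(2) by simp
  then have "det U dvd 1"
    by (metis dvd_triv_right)
  then show "unimodular U"
    using U by (auto simp: unimodular_def is_unit_poly_iff)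
qed

lemma unimodularI:
  fixes U :: "'a::field poly mat"
  assumes "U \<in> carrier_mat n n" "W \<in> carrier_mat n n" "W * U = 1\<^sub>m n"
  shows "unimodular U"
  using assms unimodular_iff_left_inverse by blast

lemma unimodular_if_right_inverse:
  fixes U :: "'a::field poly mat"
  assumes U: "U \<in> carrier_mat n n" and W: "W \<in> carrier_mat n n" "U * W = 1\<^sub>m n"
  shows "unimodular U"
proof -
  have "det U * det W = 1"
    using det_mult[OF U W(1)] W(2) by simp
  then have "det U dvd 1"
    by (metis dvd_triv_left)
  then show ?thesis
    using U by (auto simp: unimodular_def is_unit_poly_iff)
qed

lemma unimodular_mult:
  fixes U V :: "'a::field poly mat"
  assumes "U \<in> carrier_mat n n" "V \<in> carrier_mat n n" "unimodular U" "unimodular V"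
  shows "unimodular (U * V)"
  using assms det_mult[OF assms(1,2)] by (auto simp: unimodular_def)

lemma unimodular_transpose:
  fixes U :: "'a::field poly mat"
  assumes "U \<in> carrier_mat n n" "unimodular U"
  shows "unimodular (transpose_mat U)"
  using assms det_transpose[OF assms(1)] by (auto simp: unimodular_def)

lemma unimodular_diag_one:
  fixes U :: "'a::field poly mat"
  assumes U: "U \<in> carrier_mat n n" "unimodular U"
  shows "unimodular (four_block_mat U (0\<^sub>m n q) (0\<^sub>m q n) (1\<^sub>m q))"
proof -
  obtain W where W: "W \<in> carrier_mat n n" "W * U = 1\<^sub>m n"
    using U unimodular_iff_left_inverse by blast
  have "four_block_mat W (0\<^sub>m n q) (0\<^sub>m q n) (1\<^sub>m q)
      * four_block_mat U (0\<^sub>m n q) (0\<^sub>m q n) (1\<^sub>m q) = 1\<^sub>m (n + q)"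
    by (subst mult_four_block_mat[of _ n n _ q _ q]) (use U W in auto)
  then show ?thesis
    using U W by (intro unimodularI[of _ "n + q"]) auto
qed

text \<open>
  Both transformations that split off a unimodular block have this shape: an exchange of two
  block rows (or columns), with one elimination step.
\<close>
lemma unimodular_anti_one:
  fixes X :: "'a::field poly mat"
  assumes W: "W \<in> carrier_mat r r" "unimodular W" and X: "X \<in> carrier_mat m r"
  shows "unimodular (four_block_mat (0\<^sub>m r m) W (1\<^sub>m m) X)"
proof -
  obtain Z where Z: "Z \<in> carrier_mat r r" "Z * W = 1\<^sub>m r"
    using W unimodular_iff_left_inverse by blast
  have "- (X * Z) * W = - (X * (Z * W))"
    using W X Z by simp
  then have XZW: "- (X * Z) * W + X = 0\<^sub>m m r"
    using W X Z by (intro eq_matI) auto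
  have "four_block_mat (- (X * Z)) (1\<^sub>m m) Z (0\<^sub>m r m)
      * four_block_mat (0\<^sub>m r m) W (1\<^sub>m m) X = 1\<^sub>m (m + r)"
    using W X Z XZW
    by (subst mult_four_block_mat[of _ m r _ m _ r _ _ m _ r]) auto
  moreover have "four_block_mat (- (X * Z)) (1\<^sub>m m) Z (0\<^sub>m r m) \<in> carrier_mat (m + r) (r + m)"
    using X Z by (intro four_block_carrier_mat) auto
  ultimately show ?thesis
    using W X Z by (intro unimodularI[of _ "m + r"]) (auto simp: add.commute)
qed

section \<open>Unimodular equivalence\<close>

definition unimodular_equivalent :: "'a::field poly mat \<Rightarrow> 'a poly mat \<Rightarrow> bool" where
  "unimodular_equivalent M N \<longleftrightarrow> (\<exists>U V.
     U \<in> carrier_mat (dim_row M) (dim_row M) \<and> unimodular U \<and>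
     V \<in> carrier_mat (dim_col M) (dim_col M) \<and> unimodular V \<and> U * M * V = N)"

lemma unimodular_equivalentI:
  fixes M N :: "'a::field poly mat"
  assumes "M \<in> carrier_mat r c" "U \<in> carrier_mat r r" "unimodular U"
    "V \<in> carrier_mat c c" "unimodular V" "U * M * V = N"
  shows "unimodular_equivalent M N"
  unfolding unimodular_equivalent_def using assms by (metis carrier_matD)

lemma unimodular_equivalent_trans:
  fixes M N R :: "'a::field poly mat"
  assumes "unimodular_equivalent M N" "unimodular_equivalent N R"
  shows "unimodular_equivalent M R"
proof -
  obtain r c where M: "M \<in> carrier_mat r c" by blast
  obtain U V where U: "U \<in> carrier_mat r r" "unimodular U"
    and V: "V \<in> carrier_mat c c" "unimodular V" and N: "N = U * M * V"
    using assms(1) M unfolding unimodular_equivalent_def by (metis carrier_matD)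
  have UM: "U * M \<in> carrier_mat r c" and cN: "N \<in> carrier_mat r c"
    unfolding N using U(1) M V(1) by auto
  obtain U' V' where U': "U' \<in> carrier_mat r r" "unimodular U'"
    and V': "V' \<in> carrier_mat c c" "unimodular V'" and R: "R = U' * N * V'"
    using assms(2) cN unfolding unimodular_equivalent_def by (metis carrier_matD)
  have UU: "U' * U \<in> carrier_mat r r" and UUM: "U' * U * M \<in> carrier_mat r c"
    by (intro mult_carrier_mat[OF U'(1) U(1)] mult_carrier_mat[OF mult_carrier_mat[OF U'(1) U(1)] M])+
  have "(U' * U) * M * (V * V') = U' * N * V'"
    unfolding N assoc_mult_mat[OF UUM V(1) V'(1), symmetric]
      assoc_mult_mat[OF U'(1) UM V(1), symmetric] assoc_mult_mat[OF U'(1) U(1) M, symmetric] ..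
  then show ?thesis
    using unimodular_equivalentI[OF M UU unimodular_mult[OF U'(1) U(1) U'(2) U(2)]
        mult_carrier_mat[OF V(1) V'(1)] unimodular_mult[OF V(1) V'(1) V(2) V'(2)]] R by simp
qed

section \<open>Elimination of a unimodular block\<close>

text \<open>
  Block elimination with the pivot \<open>Z\<close> leaves \<open>P - X Z\<^sup>-\<^sup>1 Y\<close>. In the application the correction term
  vanishes, so \<open>P\<close> itself survives.
\<close>
lemma equivalent_Schur_complement:
  fixes P X Y Z :: "'a::field poly mat"
  assumes P: "P \<in> carrier_mat m n" and X: "X \<in> carrier_mat m r" and Y: "Y \<in> carrier_mat r n"
    and Z: "Z \<in> carrier_mat r r" and W: "W \<in> carrier_mat r r" "W * Z = 1\<^sub>m r"
    and XWY: "X * (W * Y) = 0\<^sub>m m n"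
  shows "unimodular_equivalent (four_block_mat P X Y Z)
    (four_block_mat (1\<^sub>m r) (0\<^sub>m r n) (0\<^sub>m m r) P)"
proof -
  define U where "U = four_block_mat (0\<^sub>m r m) W (1\<^sub>m m) (- (X * W))"
  define V where "V = four_block_mat (0\<^sub>m n r) (1\<^sub>m n) (1\<^sub>m r) (- (W * Y))"
  have UW: "unimodular W"
    using unimodular_if_right_inverse[OF W(1) Z W(2)] .
  have U: "U \<in> carrier_mat (m + r) (m + r)"
  proof -
    have "U \<in> carrier_mat (r + m) (m + r)"
      unfolding U_def using X W by (intro four_block_carrier_mat) auto
    then show ?thesis by (simp add: add.commute)
  qed
  have uU: "unimodular U"
    unfolding U_def using UW W X by (intro unimodular_anti_one) auto
  have V: "V \<in> carrier_mat (n + r) (n + r)"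
  proof -
    have "V \<in> carrier_mat (n + r) (r + n)"
      unfolding V_def using Y W by (intro four_block_carrier_mat) auto
    then show ?thesis by (simp add: add.commute)
  qed
  have uV: "unimodular V"
    unfolding V_def using W Y
    by (intro unimodular_anti_one unimodularI[of "1\<^sub>m n" n "1\<^sub>m n"]) auto
  have a1: "- (X * W) * Y = 0\<^sub>m m n"
    using X W Y XWY by auto
  have a2: "- (X * W) * Z = - X"
    using X W Z by auto
  have a3: "W * Y + - (W * Y) = 0\<^sub>m r n"
    using W Y by (intro eq_matI) auto
  have "U * four_block_mat P X Y Z = four_block_mat (W * Y) (1\<^sub>m r) P (0\<^sub>m m r)"
    unfolding U_def using P X Y Z W a1 a2
    by (subst mult_four_block_mat[of _ r m _ r _ m _ _ n _ r])
       (auto intro!: cong_four_block_mat)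
  also have "\<dots> * V = four_block_mat (1\<^sub>m r) (0\<^sub>m r n) (0\<^sub>m m r) P"
    unfolding V_def using P Y W a3
    by (subst mult_four_block_mat[of _ r n _ r _ m _ _ r _ n])
       (auto intro!: cong_four_block_mat)
  finally show ?thesis
    using P Z U uU V uV
    by (intro unimodular_equivalentI[of _ "m + r" "n + r" U V]) auto
qed

text \<open>
  This is the block row \<open>[0 I\<^sub>p]\<close> whose zero block has \<open>n\<close> columns. It is the normal form of a
  matrix that can be completed to a unimodular one.
\<close>
definition shift_mat :: "nat \<Rightarrow> nat \<Rightarrow> 'a::{zero,one} mat" where
  "shift_mat p n = mat p (n + p) (\<lambda>(i, j). if j = n + i then 1 else 0)"

lemma shift_mat_carrier[simp]: "shift_mat p n \<in> carrier_mat p (n + p)"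
  by (simp add: shift_mat_def)

text \<open>
  Split \<open>A\<close> as \<open>[P A\<^sub>1; A\<^sub>2 A\<^sub>3]\<close> with \<open>P\<close> of size \<open>m \<times> n\<close>. All of the matrix except the block row and
  block column of \<open>P\<close> is \<open>Z = [A\<^sub>3 I; I 0]\<close>, with inverse \<open>W = [0 I; I -A\<^sub>3]\<close>. The off-diagonal blocks are
  \<open>X = [A\<^sub>1 0]\<close> and \<open>Y = [A\<^sub>2; 0]\<close>; since \<open>W\<close> moves the nonzero part of \<open>Y\<close> to the place where \<open>X\<close> is zero,
  \<open>X W Y = 0\<close>.
\<close>
lemma equivalent_anti_triangular:
  fixes A :: "'a::field poly mat"
  assumes A: "A \<in> carrier_mat (m + p) (n + q)"
  shows "unimodular_equivalent
    (four_block_mat A (transpose_mat (shift_mat p m)) (shift_mat q n) (0\<^sub>m q p))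
    (four_block_mat (1\<^sub>m (p + q)) (0\<^sub>m (p + q) n) (0\<^sub>m m (p + q)) (mat m n (\<lambda>ij. A $$ ij)))"
proof -
  obtain P A12 A21 A22 where "split_block A m n = (P, A12, A21, A22)"
    by (cases "split_block A m n") auto
  note sp = split_block[OF this, of p q]
  have dims: "dim_row A = m + p" "dim_col A = n + q" using A by auto
  note c = sp(1-4)[OF dims] and Aeq = sp(5)[OF dims]
  have P: "mat m n (\<lambda>ij. A $$ ij) = P"
    using c by (auto simp: Aeq)
  define X where "X = mat m (p + q) (\<lambda>(i, j). if j < q then A12 $$ (i, j) else 0)"
  define Y where "Y = mat (p + q) n (\<lambda>(i, j). if i < p then A21 $$ (i, j) else 0)"
  define Z where "Z = mat (p + q) (p + q) (\<lambda>(i, j).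
    if i < p then if j < q then A22 $$ (i, j) else of_bool (j = q + i) else of_bool (i = p + j))"
  define W where "W = four_block_mat (0\<^sub>m q p) (1\<^sub>m q) (1\<^sub>m p) (- A22)"
  have Zeq: "Z = four_block_mat A22 (1\<^sub>m p) (1\<^sub>m q) (0\<^sub>m q p)"
    using c by (intro eq_matI) (auto simp: Z_def)
  have XY: "X \<in> carrier_mat m (p + q)" "Y \<in> carrier_mat (p + q) n" "Z \<in> carrier_mat (p + q) (p + q)"
    by (auto simp: X_def Y_def Z_def)
  have W: "W \<in> carrier_mat (p + q) (p + q)"
    using c by (intro carrier_matI) (auto simp: W_def)
  have A22: "A22 + - A22 = 0\<^sub>m p q"
    using c by (intro eq_matI) auto
  have WZ: "W * Z = 1\<^sub>m (p + q)"
    unfolding W_def Zeq using c A22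
    by (subst mult_four_block_mat[of _ q p _ q _ p _ _ q _ p]) (auto simp: add.commute)
  \<comment> \<open>only the first \<open>q\<close> rows of \<open>W Y\<close> matter, because \<open>X\<close> vanishes on the other columns\<close>
  have WY: "(W * Y) $$ (i, j) = 0" if "i < q" "j < n" for i j
    using that W XY(2) c
    by (subst mult_mat_entry[OF W XY(2)]) (auto simp: W_def Y_def intro!: sum.neutral)
  have "X * (W * Y) = 0\<^sub>m m n"
  proof (intro eq_matI)
    fix i j assume ij: "i < dim_row (0\<^sub>m m n)" "j < dim_col (0\<^sub>m m n)"
    have "(X * (W * Y)) $$ (i, j) = (\<Sum>k<p + q. X $$ (i, k) * (W * Y) $$ (k, j))"
      using ij W XY by (intro mult_mat_entry) auto
    also have "\<dots> = 0"
      using ij by (intro sum.neutral) (auto simp: X_def WY)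
    finally show "(X * (W * Y)) $$ (i, j) = 0\<^sub>m m n $$ (i, j)" using ij by simp
  qed (use XY in auto)
  moreover have "four_block_mat A (transpose_mat (shift_mat p m)) (shift_mat q n) (0\<^sub>m q p)
     = four_block_mat P X Y Z"
  proof (intro eq_matI)
    fix i j assume "i < dim_row (four_block_mat P X Y Z)" "j < dim_col (four_block_mat P X Y Z)"
    then have ij: "i < m + (p + q)" "j < n + (q + p)" using c XY by auto
    consider "i < m" | "m \<le> i" "i < m + p" | "m + p \<le> i" by linarith
    then show "four_block_mat A (transpose_mat (shift_mat p m)) (shift_mat q n) (0\<^sub>m q p) $$ (i, j)
        = four_block_mat P X Y Z $$ (i, j)"
    proof cases
      case 1
      then show ?thesis
        using ij c dims by (auto simp: Aeq X_def Y_def Z_def shift_mat_def)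
    next
      case 2
      then show ?thesis
        using ij c dims by (cases "j < n + q") (auto simp: Aeq X_def Y_def Z_def shift_mat_def)
    next
      case 3
      then show ?thesis
        using ij c dims by (cases "j < n + q") (auto simp: Aeq X_def Y_def Z_def shift_mat_def)
    qed
  qed (use c XY dims in \<open>auto simp: shift_mat_def\<close>)
  ultimately show ?thesis
    using equivalent_Schur_complement[OF c(1) XY W WZ] P by simp
qed

text \<open>
  The matrices \<open>Q\<close> and \<open>V\<close> bring the two off-diagonal blocks to normal form at once. The polynomial
  that survives is the corner of \<open>Q A V\<close>, which depends only on the first \<open>m\<close> rows of \<open>Q\<close> and the
  first \<open>n\<close> columns of \<open>V\<close>: these span the left null space of \<open>C\<close> and the null space of \<open>D\<close>.
\<close>
lemma equivalent_with_completions: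
  fixes A C D Q V :: "'a::field poly mat"
  assumes A: "A \<in> carrier_mat (m + p) (n + q)"
    and C: "C \<in> carrier_mat (m + p) p" and D: "D \<in> carrier_mat q (n + q)"
    and Q: "Q \<in> carrier_mat (m + p) (m + p)" "unimodular Q" "Q * C = transpose_mat (shift_mat p m)"
    and V: "V \<in> carrier_mat (n + q) (n + q)" "unimodular V" "D * V = shift_mat q n"
  shows "unimodular_equivalent (four_block_mat A C D (0\<^sub>m q p))
    (four_block_mat (1\<^sub>m (p + q)) (0\<^sub>m (p + q) n) (0\<^sub>m m (p + q))
      (mat m n (\<lambda>ij. (Q * A * V) $$ ij)))"
proof -
  let ?Q = "four_block_mat Q (0\<^sub>m (m + p) q) (0\<^sub>m q (m + p)) (1\<^sub>m q)"
  let ?V = "four_block_mat V (0\<^sub>m (n + q) p) (0\<^sub>m p (n + q)) (1\<^sub>m p)"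
  have QC: "Q * C \<in> carrier_mat (m + p) p"
    using Q C by auto
  have 1: "?Q * four_block_mat A C D (0\<^sub>m q p) = four_block_mat (Q * A) (Q * C) D (0\<^sub>m q p)"
    using A C D Q(1)
    by (subst mult_four_block_mat[of _ "m + p" "m + p" _ q _ q _ _ "n + q" _ p]) auto
  have 2: "\<dots> * ?V = four_block_mat (Q * A * V) (Q * C) (D * V) (0\<^sub>m q p)"
    using A QC D Q(1) V(1)
    by (subst mult_four_block_mat[of _ "m + p" "n + q" _ p _ q _ _ "n + q" _ p]) auto
  have "unimodular_equivalent (four_block_mat A C D (0\<^sub>m q p))
      (four_block_mat (Q * A * V) (transpose_mat (shift_mat p m)) (shift_mat q n) (0\<^sub>m q p))"
    using A Q V 1 2
    by (intro unimodular_equivalentI[of _ "m + p + q" "n + q + p" ?Q ?V])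
       (auto intro!: unimodular_diag_one)
  moreover have "Q * A * V \<in> carrier_mat (m + p) (n + q)"
    using A Q V by auto
  ultimately show ?thesis
    using unimodular_equivalent_trans equivalent_anti_triangular by blast
qed

section \<open>Kronecker products with an identity matrix\<close>

lemma kronecker_carrier[simp]:
  "A \<in> carrier_mat a b \<Longrightarrow> B \<in> carrier_mat x y \<Longrightarrow> kronecker A B \<in> carrier_mat (a * x) (b * y)"
  by (auto simp: kronecker_def)

lemma mult_add_less_mult:
  fixes i j :: nat
  assumes "i < a" "j < b"
  shows "i * b + j < a * b"
proof -
  have "i * b + j < Suc i * b" using assms by simp
  also have "\<dots> \<le> a * b" using assms by (intro mult_right_mono) auto
  finally show ?thesis .
qed

lemma sum_div_mod:
  fixes f :: "nat \<Rightarrow> nat \<Rightarrow> 'b::comm_monoid_add"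
  shows "(\<Sum>k<a * b. f (k div b) (k mod b)) = (\<Sum>i<a. \<Sum>j<b. f i j)"
  unfolding sum.cartesian_product
  by (rule sum.reindex_bij_witness[of _ "\<lambda>(i, j). i * b + j" "\<lambda>k. (k div b, k mod b)"])
     (auto simp: mult_add_less_mult less_mult_imp_div_less,
      metis mod_less_divisor mult_0_right not_less_zero neq0_conv)

lemma index_kronecker:
  assumes "A \<in> carrier_mat a b" "B \<in> carrier_mat x y" "r < a * x" "c < b * y"
  shows "kronecker A B $$ (r, c) = A $$ (r div x, c div y) * B $$ (r mod x, c mod y)"
  using assms by (auto simp: kronecker_def)

lemma div_mod_less:
  fixes r :: nat
  assumes "r < a * x"
  shows "r div x < a" "r mod x < x"
proof -
  have "0 < x" using assms by (cases x) auto
  then show "r div x < a" "r mod x < x"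
    using assms by (auto simp: less_mult_imp_div_less)
qed

lemma kronecker_mult:
  fixes A B C D :: "'b::comm_semiring_0 mat"
  assumes A: "A \<in> carrier_mat a b" and B: "B \<in> carrier_mat x y"
    and C: "C \<in> carrier_mat b c" and D: "D \<in> carrier_mat y z"
  shows "kronecker A B * kronecker C D = kronecker (A * C) (B * D)"
proof (intro eq_matI)
  fix i j assume "i < dim_row (kronecker (A * C) (B * D))" "j < dim_col (kronecker (A * C) (B * D))"
  then have ij: "i < a * x" "j < c * z"
    using assms by (auto simp: kronecker_def)
  note d = div_mod_less[OF ij(1)] div_mod_less[OF ij(2)]
  have "(kronecker A B * kronecker C D) $$ (i, j)
      = (\<Sum>k<b * y. kronecker A B $$ (i, k) * kronecker C D $$ (k, j))"
    using assms ij by (intro mult_mat_entry) auto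
  also have "\<dots> = (\<Sum>k<b * y. (\<lambda>s t. (A $$ (i div x, s) * C $$ (s, j div z))
      * (B $$ (i mod x, t) * D $$ (t, j mod z))) (k div y) (k mod y))"
    using ij by (intro sum.cong) (auto simp: index_kronecker[OF A B] index_kronecker[OF C D] ac_simps)
  also have "\<dots> = (\<Sum>s<b. \<Sum>t<y. (A $$ (i div x, s) * C $$ (s, j div z))
      * (B $$ (i mod x, t) * D $$ (t, j mod z)))"
    by (rule sum_div_mod)
  also have "\<dots> = (\<Sum>s<b. A $$ (i div x, s) * C $$ (s, j div z))
      * (\<Sum>t<y. B $$ (i mod x, t) * D $$ (t, j mod z))"
    by (simp add: sum_product)
  also have "\<dots> = (A * C) $$ (i div x, j div z) * (B * D) $$ (i mod x, j mod z)"
    using d by (simp only: mult_mat_entry[OF A C] mult_mat_entry[OF B D])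
  also have "\<dots> = kronecker (A * C) (B * D) $$ (i, j)"
    using assms ij by (intro index_kronecker[symmetric]) auto
  finally show "(kronecker A B * kronecker C D) $$ (i, j) = kronecker (A * C) (B * D) $$ (i, j)" .
qed (use assms in \<open>auto simp: kronecker_def\<close>)

lemma kronecker_one: "kronecker (1\<^sub>m a) (1\<^sub>m b) = (1\<^sub>m (a * b) :: 'b::semiring_1 mat)"
proof (intro eq_matI)
  fix i j assume "i < dim_row (1\<^sub>m (a * b) :: 'b mat)" "j < dim_col (1\<^sub>m (a * b) :: 'b mat)"
  then have ij: "i < a * b" "j < a * b" by auto
  have "i = j \<longleftrightarrow> i div b = j div b \<and> i mod b = j mod b"
    by (metis div_mult_mod_eq)
  then show "kronecker (1\<^sub>m a) (1\<^sub>m b) $$ (i, j) = (1\<^sub>m (a * b) :: 'b mat) $$ (i, j)"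
    using ij div_mod_less[OF ij(1)] div_mod_less[OF ij(2)] by (auto simp: kronecker_def)
qed (auto simp: kronecker_def)

lemma transpose_kronecker:
  "transpose_mat (kronecker A B) = kronecker (transpose_mat A) (transpose_mat B)"
  by (intro eq_matI) (auto simp: kronecker_def div_mod_less)

lemma kronecker_shift:
  "kronecker (shift_mat k 1) (1\<^sub>m n) = (shift_mat (k * n) n :: 'b::semiring_1 mat)"
proof (intro eq_matI)
  fix i j assume "i < dim_row (shift_mat (k * n) n :: 'b mat)" "j < dim_col (shift_mat (k * n) n :: 'b mat)"
  then have ij: "i < k * n" "j < (Suc k) * n" by (auto simp: shift_mat_def)
  then have n: "0 < n" by (cases n) auto
  have "j = n + i \<longleftrightarrow> j div n = Suc (i div n) \<and> j mod n = i mod n"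
  proof
    assume "j div n = Suc (i div n) \<and> j mod n = i mod n"
    then have "j = Suc (i div n) * n + i mod n"
      by (metis div_mult_mod_eq)
    then show "j = n + i" by simp
  qed (use n in auto)
  then show "kronecker (shift_mat k 1) (1\<^sub>m n) $$ (i, j) = (shift_mat (k * n) n :: 'b mat) $$ (i, j)"
    using ij div_mod_less[OF ij(1)] div_mod_less[OF ij(2)] by (auto simp: kronecker_def shift_mat_def)
qed (auto simp: kronecker_def shift_mat_def)

lemma unimodular_kronecker_one:
  fixes V :: "'a::field poly mat"
  assumes V: "V \<in> carrier_mat k k" "unimodular V"
  shows "unimodular (kronecker V (1\<^sub>m n))"
proof -
  obtain W where W: "W \<in> carrier_mat k k" "W * V = 1\<^sub>m k"
    using V unimodular_iff_left_inverse by blast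
  have "kronecker W (1\<^sub>m n) * kronecker V (1\<^sub>m n) = 1\<^sub>m (k * n)"
    using W V by (subst kronecker_mult[of _ k k _ n n _ k _ n]) (auto simp: kronecker_one)
  then show ?thesis
    using V W by (intro unimodularI[of _ "k * n" "kronecker W (1\<^sub>m n)"]) auto
qed

section \<open>Completion of a bidiagonal matrix\<close>

text \<open>
  With \<open>a = -1\<close>, \<open>b = \<lambda>\<^sup>l\<close> this is \<open>L\<^sub>k(\<lambda>\<^sup>l)\<close>, and with \<open>a = -\<lambda>\<^sup>l\<close>, \<open>b = 1\<close> its reversal, so that one
  argument with \<open>a = -y\<close>, \<open>b = x\<close> serves both.
\<close>
definition bidiag :: "nat \<Rightarrow> 'b::zero \<Rightarrow> 'b \<Rightarrow> 'b mat" where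
  "bidiag k a b = mat k (Suc k) (\<lambda>(i, j). if j = i then a else if j = i + 1 then b else 0)"

lemma bidiag_carrier[simp]: "bidiag k a b \<in> carrier_mat k (Suc k)"
  by (simp add: bidiag_def)

lemma bidiag_mult_entry:
  fixes a b :: "'b::comm_ring_1"
  assumes V: "V \<in> carrier_mat (Suc k) c" and ij: "i < k" "j < c"
  shows "(bidiag k a b * V) $$ (i, j) = a * V $$ (i, j) + b * V $$ (i + 1, j)"
proof -
  have "(bidiag k a b * V) $$ (i, j) = (\<Sum>t<Suc k. bidiag k a b $$ (i, t) * V $$ (t, j))"
    using ij V by (intro mult_mat_entry) auto
  also have "\<dots> = (\<Sum>t\<in>{i, i + 1}. bidiag k a b $$ (i, t) * V $$ (t, j))"
    using ij by (intro sum.mono_neutral_right) (auto simp: bidiag_def)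
  also have "\<dots> = a * V $$ (i, j) + b * V $$ (i + 1, j)"
    using ij by (simp add: bidiag_def)
  finally show ?thesis .
qed

text \<open>
  If row \<open>t\<close> of \<open>V\<close> is the first unit vector, then putting the \<open>t\<close>-th unit vector on top of \<open>D\<close>
  gives a left inverse of \<open>V\<close>.
\<close>
lemma unimodular_completion:
  fixes D V :: "'a::field poly mat"
  assumes D: "D \<in> carrier_mat k (Suc k)" and V: "V \<in> carrier_mat (Suc k) (Suc k)"
    and DV: "D * V = shift_mat k 1"
    and t: "t \<le> k" "\<And>j. j \<le> k \<Longrightarrow> V $$ (t, j) = (if j = 0 then 1 else 0)"
  shows "unimodular V"
proof -
  define W where "W = mat (Suc k) (Suc k)
    (\<lambda>(i, j). if i = 0 then if j = t then 1 else 0 else D $$ (i - 1, j))"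
  have W: "W \<in> carrier_mat (Suc k) (Suc k)" by (simp add: W_def)
  have "W * V = 1\<^sub>m (Suc k)"
  proof (intro eq_matI)
    fix i j assume "i < dim_row (1\<^sub>m (Suc k) :: 'a poly mat)" "j < dim_col (1\<^sub>m (Suc k) :: 'a poly mat)"
    then have ij: "i < Suc k" "j < Suc k" by auto
    have e: "(W * V) $$ (i, j) = (\<Sum>s<Suc k. W $$ (i, s) * V $$ (s, j))"
      using W V ij by (intro mult_mat_entry) auto
    show "(W * V) $$ (i, j) = 1\<^sub>m (Suc k) $$ (i, j)"
    proof (cases i)
      case 0
      have "(\<Sum>s<Suc k. W $$ (i, s) * V $$ (s, j)) = (\<Sum>s<Suc k. if s = t then V $$ (s, j) else 0)"
        using 0 by (intro sum.cong) (auto simp: W_def)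
      then show ?thesis
        using 0 e ij t by auto
    next
      case (Suc i')
      have "(\<Sum>s<Suc k. W $$ (i, s) * V $$ (s, j)) = (\<Sum>s<Suc k. D $$ (i', s) * V $$ (s, j))"
        using ij Suc by (intro sum.cong) (auto simp: W_def)
      also have "\<dots> = (D * V) $$ (i', j)"
        using D V ij Suc by (intro mult_mat_entry[symmetric]) auto
      finally show ?thesis
        using e DV ij Suc by (auto simp: shift_mat_def)
    qed
  qed (use W V in auto)
  then show ?thesis
    using W V by (intro unimodularI)
qed

text \<open>
  The first column is the null vector \<open>(x\<^sup>k, x\<^bsup>k-1\<^esup>y, \<dots>, y\<^sup>k)\<close> of the bidiagonal matrix; the other
  columns solve \<open>-y v\<^sub>i + x v\<^bsub>i+1\<^esub> = \<delta>\<^bsub>ij\<^esub>\<close> by recursion, which needs no division because one of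
  \<open>x\<close>, \<open>y\<close> is \<open>1\<close>: backwards from \<open>v\<^sub>k = 0\<close> if \<open>y = 1\<close>, forwards from \<open>v\<^sub>0 = 0\<close> if \<open>x = 1\<close>.
\<close>
lemma bidiag_completion:
  fixes x y :: "'a::field poly"
  assumes "x = 1 \<or> y = 1"
  obtains V where "V \<in> carrier_mat (Suc k) (Suc k)" "unimodular V"
    "bidiag k (- y) x * V = shift_mat k 1" "\<And>i. i \<le> k \<Longrightarrow> V $$ (i, 0) = x ^ (k - i) * y ^ i"
proof -
  from assms consider "y = 1" | "x = 1" by blast
  then show ?thesis
  proof cases
    case 1
    define V where "V = mat (Suc k) (Suc k)
      (\<lambda>(i, j). if j = 0 then x ^ (k - i) else if i < j then - (x ^ (j - 1 - i)) else 0)"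
    have V: "V \<in> carrier_mat (Suc k) (Suc k)" by (simp add: V_def)
    have DV: "bidiag k (- y) x * V = shift_mat k 1"
    proof (intro eq_matI)
      fix i j assume "i < dim_row (shift_mat k 1 :: 'a poly mat)" "j < dim_col (shift_mat k 1 :: 'a poly mat)"
      then have ij: "i < k" "j < Suc k" by (auto simp: shift_mat_def)
      have x0: "x ^ (k - i) = x * x ^ (k - Suc i)"
        using ij by (simp add: Suc_diff_Suc flip: power_Suc)
      have xj: "x ^ (j - 1 - i) = x * x ^ (j - 1 - Suc i)" if "Suc i < j"
        using that by (simp add: Suc_diff_Suc flip: power_Suc)
      show "(bidiag k (- y) x * V) $$ (i, j) = shift_mat k 1 $$ (i, j)"
        using ij 1 x0 xj by (subst bidiag_mult_entry[OF V]) (auto simp: V_def shift_mat_def)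
    qed (auto simp: V_def shift_mat_def bidiag_def)
    have "unimodular V"
      by (rule unimodular_completion[OF bidiag_carrier V DV, of k]) (auto simp: V_def)
    then show ?thesis
      using that[OF V _ DV] 1 by (auto simp: V_def)
  next
    case 2
    define V where "V = mat (Suc k) (Suc k)
      (\<lambda>(i, j). if j = 0 then y ^ i else if j \<le> i then y ^ (i - j) else 0)"
    have V: "V \<in> carrier_mat (Suc k) (Suc k)" by (simp add: V_def)
    have DV: "bidiag k (- y) x * V = shift_mat k 1"
    proof (intro eq_matI)
      fix i j assume "i < dim_row (shift_mat k 1 :: 'a poly mat)" "j < dim_col (shift_mat k 1 :: 'a poly mat)"
      then have ij: "i < k" "j < Suc k" by (auto simp: shift_mat_def)
      have yj: "y ^ (Suc i - j) = y * y ^ (i - j)" if "j \<le> i"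
        using that by (simp add: Suc_diff_le)
      show "(bidiag k (- y) x * V) $$ (i, j) = shift_mat k 1 $$ (i, j)"
        using ij 2 yj by (subst bidiag_mult_entry[OF V]) (auto simp: V_def shift_mat_def le_Suc_eq)
    qed (auto simp: V_def shift_mat_def bidiag_def)
    have "unimodular V"
      by (rule unimodular_completion[OF bidiag_carrier V DV, of 0]) (auto simp: V_def)
    then show ?thesis
      using that[OF V _ DV] 2 by (auto simp: V_def)
  qed
qed

text \<open>
  The completions of the two bidiagonal matrices, tensored with identity matrices, complete the
  off-diagonal blocks. The corner of the transformed matrix is then the contraction of the blocks
  of \<open>A\<close> with the two null vectors.
\<close>
lemma block_bidiag_equivalent:
  fixes x y :: "'a::field poly"
  assumes xy: "x = 1 \<or> y = 1" and A: "A \<in> carrier_mat (Suc h * m) (Suc e * n)"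
  shows "unimodular_equivalent
    (four_block_mat A (kronecker (transpose_mat (bidiag h (- y) x)) (1\<^sub>m m))
      (kronecker (bidiag e (- y) x) (1\<^sub>m n)) (0\<^sub>m (e * n) (h * m)))
    (four_block_mat (1\<^sub>m (h * m + e * n)) (0\<^sub>m (h * m + e * n) n) (0\<^sub>m m (h * m + e * n))
      (mat m n (\<lambda>(a, b). \<Sum>i\<le>h. \<Sum>j\<le>e.
         (x ^ (h - i) * y ^ i) * (x ^ (e - j) * y ^ j) * A $$ (i * m + a, j * n + b))))"
proof -
  obtain U where U: "U \<in> carrier_mat (Suc h) (Suc h)" "unimodular U"
    "bidiag h (- y) x * U = shift_mat h 1" "\<And>i. i \<le> h \<Longrightarrow> U $$ (i, 0) = x ^ (h - i) * y ^ i"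
    using bidiag_completion[OF xy] by blast
  obtain V where V: "V \<in> carrier_mat (Suc e) (Suc e)" "unimodular V"
    "bidiag e (- y) x * V = shift_mat e 1" "\<And>i. i \<le> e \<Longrightarrow> V $$ (i, 0) = x ^ (e - i) * y ^ i"
    using bidiag_completion[OF xy] by blast
  define Q where "Q = kronecker (transpose_mat U) (1\<^sub>m m)"
  define R where "R = kronecker V (1\<^sub>m n)"
  have "kronecker (bidiag h (- y) x) (1\<^sub>m m) * kronecker U (1\<^sub>m m) = shift_mat (h * m) m"
    using U by (subst kronecker_mult[of _ h "Suc h" _ m m _ "Suc h" _ m])
      (auto simp: kronecker_shift[unfolded One_nat_def])
  moreover have "transpose_mat (kronecker (bidiag h (- y) x) (1\<^sub>m m) * kronecker U (1\<^sub>m m))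
      = Q * kronecker (transpose_mat (bidiag h (- y) x)) (1\<^sub>m m)"
    using U(1) by (subst transpose_mult[of _ "h * m" "Suc h * m" _ "Suc h * m"])
      (intro kronecker_carrier bidiag_carrier one_carrier_mat,
        simp_all add: Q_def transpose_kronecker del: mult_Suc)
  ultimately have QC: "Q * kronecker (transpose_mat (bidiag h (- y) x)) (1\<^sub>m m)
      = transpose_mat (shift_mat (h * m) m)"
    by simp
  have DR: "kronecker (bidiag e (- y) x) (1\<^sub>m n) * R = shift_mat (e * n) n"
    unfolding R_def using V by (subst kronecker_mult[of _ e "Suc e" _ n n _ "Suc e" _ n])
      (auto simp: kronecker_shift[unfolded One_nat_def])
  have Q: "Q \<in> carrier_mat (Suc h * m) (Suc h * m)"
    unfolding Q_def using U(1) by (intro kronecker_carrier) auto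
  have uQ: "unimodular Q"
    unfolding Q_def using U(1,2)
    by (intro unimodular_kronecker_one[of _ "Suc h"] unimodular_transpose[of _ "Suc h"]) auto
  have R: "R \<in> carrier_mat (Suc e * n) (Suc e * n)"
    unfolding R_def using V(1) by (intro kronecker_carrier) auto
  have uR: "unimodular R"
    unfolding R_def using V(1,2) by (intro unimodular_kronecker_one[of _ "Suc e"]) auto
  have entry: "(Q * A * R) $$ (a, b) = (\<Sum>i\<le>h. \<Sum>j\<le>e.
         (x ^ (h - i) * y ^ i) * (x ^ (e - j) * y ^ j) * A $$ (i * m + a, j * n + b))"
    if ab: "a < m" "b < n" for a b
  proof -
    have QA: "Q * A \<in> carrier_mat (Suc h * m) (Suc e * n)" by (rule mult_carrier_mat[OF Q A])
    have aa: "a < Suc h * m" and bb: "b < Suc e * n" using ab by auto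
    have Qe: "Q $$ (a, r) = (if r mod m = a then U $$ (r div m, 0) else 0)" if r: "r < Suc h * m" for r
      using U r ab aa div_mod_less[OF r] unfolding Q_def
      by (subst index_kronecker[of _ "Suc h" "Suc h" _ m m]) auto
    have Re: "R $$ (c, b) = (if c mod n = b then V $$ (c div n, 0) else 0)" if c: "c < Suc e * n" for c
      using V c ab bb div_mod_less[OF c] unfolding R_def
      by (subst index_kronecker[of _ "Suc e" "Suc e" _ n n]) auto
    have QAe: "(Q * A) $$ (a, c) = (\<Sum>i\<le>h. U $$ (i, 0) * A $$ (i * m + a, c))"
      if c: "c < Suc e * n" for c
    proof -
      have "(Q * A) $$ (a, c) = (\<Sum>r<Suc h * m. Q $$ (a, r) * A $$ (r, c))"
        using mult_mat_entry[OF Q A aa c] .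
      also have "\<dots> = (\<Sum>r<Suc h * m.
          (\<lambda>i s. if s = a then U $$ (i, 0) * A $$ (i * m + s, c) else 0) (r div m) (r mod m))"
        by (intro sum.cong) (auto simp: Qe)
      also have "\<dots> = (\<Sum>i<Suc h. \<Sum>s<m. if s = a then U $$ (i, 0) * A $$ (i * m + s, c) else 0)"
        by (rule sum_div_mod)
      also have "\<dots> = (\<Sum>i\<le>h. U $$ (i, 0) * A $$ (i * m + a, c))"
        using ab by (simp add: lessThan_Suc_atMost)
      finally show ?thesis .
    qed
    have "(Q * A * R) $$ (a, b) = (\<Sum>c<Suc e * n. (Q * A) $$ (a, c) * R $$ (c, b))"
      using mult_mat_entry[OF QA R aa bb] .
    also have "\<dots> = (\<Sum>c<Suc e * n.
        (\<lambda>j s. if s = b then (Q * A) $$ (a, j * n + s) * V $$ (j, 0) else 0) (c div n) (c mod n))"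
      by (intro sum.cong) (auto simp: Re)
    also have "\<dots> = (\<Sum>j<Suc e. \<Sum>s<n. if s = b then (Q * A) $$ (a, j * n + s) * V $$ (j, 0) else 0)"
      by (rule sum_div_mod)
    also have "\<dots> = (\<Sum>j\<le>e. (Q * A) $$ (a, j * n + b) * V $$ (j, 0))"
      using ab by (simp add: lessThan_Suc_atMost)
    also have "\<dots> = (\<Sum>j\<le>e. \<Sum>i\<le>h. U $$ (i, 0) * A $$ (i * m + a, j * n + b) * V $$ (j, 0))"
      using ab by (intro sum.cong) (auto simp: QAe mult_add_less_mult sum_distrib_right simp del: mult_Suc)
    also have "\<dots> = (\<Sum>i\<le>h. \<Sum>j\<le>e. U $$ (i, 0) * A $$ (i * m + a, j * n + b) * V $$ (j, 0))"
      by (rule sum.swap)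
    also have "\<dots> = (\<Sum>i\<le>h. \<Sum>j\<le>e.
         (x ^ (h - i) * y ^ i) * (x ^ (e - j) * y ^ j) * A $$ (i * m + a, j * n + b))"
      by (intro sum.cong) (auto simp: U V ac_simps)
    finally show ?thesis .
  qed
  have eq: "mat m n (\<lambda>ij. (Q * A * R) $$ ij) = mat m n (\<lambda>(a, b). \<Sum>i\<le>h. \<Sum>j\<le>e.
         (x ^ (h - i) * y ^ i) * (x ^ (e - j) * y ^ j) * A $$ (i * m + a, j * n + b))"
    by (intro eq_matI) (auto simp: entry)
  note h = mult_Suc[of h m] mult_Suc[of e n]
  have C: "kronecker (transpose_mat (bidiag h (- y) x)) (1\<^sub>m m) \<in> carrier_mat (Suc h * m) (h * m)"
    and D: "kronecker (bidiag e (- y) x) (1\<^sub>m n) \<in> carrier_mat (e * n) (Suc e * n)"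
    by (intro kronecker_carrier; simp)+
  show ?thesis
    unfolding eq[symmetric]
    by (rule equivalent_with_completions[OF A[unfolded h] C[unfolded h] D[unfolded h]
        Q[unfolded h] uQ QC R[unfolded h] uR DR])
qed

section \<open>Reversal with respect to a grade\<close>

definition rev_grade :: "nat \<Rightarrow> 'b::comm_monoid_add poly \<Rightarrow> 'b poly" where
  "rev_grade d p = (\<Sum>i\<le>d. monom (coeff p i) (d - i))"

lemma mat_rev_eq: "mat_rev d P = map_mat (rev_grade d) P"
  by (simp add: mat_rev_def rev_grade_def[abs_def])

lemma coeff_rev_grade: "coeff (rev_grade d p) j = (if j \<le> d then coeff p (d - j) else 0)"
proof -
  have "coeff (rev_grade d p) j = (\<Sum>i\<le>d. if d - i = j then coeff p i else 0)"
    by (simp add: rev_grade_def coeff_sum)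
  also have "\<dots> = (\<Sum>i\<le>d. if i = d - j then if j \<le> d then coeff p i else 0 else 0)"
    by (intro sum.cong) auto
  finally show ?thesis by simp
qed

lemma rev_grade_0[simp]: "rev_grade d 0 = 0"
  by (simp add: poly_eq_iff coeff_rev_grade)

lemma rev_grade_sum: "rev_grade d (\<Sum>i\<in>S. f i) = (\<Sum>i\<in>S. rev_grade d (f i))"
  by (simp add: poly_eq_iff coeff_rev_grade coeff_sum)

text \<open>
  Here \<open>\<lambda>\<^bsup>u+v+l\<^esup> (\<lambda>\<^bsup>-u\<^esup> p(\<lambda>\<^sup>-\<^sup>1)) = \<lambda>\<^sup>v (\<lambda>\<^sup>l p(\<lambda>\<^sup>-\<^sup>1))\<close>: reversal exchanges the two null vectors.
\<close>
lemma rev_grade_monom_mult: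
  fixes p :: "'b::comm_semiring_1 poly"
  assumes "\<And>i. i > l \<Longrightarrow> coeff p i = 0"
  shows "rev_grade (u + v + l) (monom 1 u * p) = monom 1 v * rev_grade l p"
proof (rule poly_eqI)
  fix j
  have "u + v + l - j - u = l - (j - v)" if "v \<le> j" "u \<le> u + v + l - j" using that by linarith
  then show "coeff (rev_grade (u + v + l) (monom 1 u * p)) j = coeff (monom 1 v * rev_grade l p) j"
    using assms by (auto simp: coeff_rev_grade coeff_monom_mult)
qed

section \<open>Cutting a polynomial into segments\<close>

text \<open>
  This is the scalar version of \<open>B\<^sub>t\<close>. The segments meet at the exponents divisible by \<open>l\<close>;
  each such coefficient is kept at the upper end of the lower segment, which is why only the first
  segment has a constant term.
\<close>
definition segment :: "nat \<Rightarrow> 'b::comm_monoid_add poly \<Rightarrow> nat \<Rightarrow> 'b poly" where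
  "segment l p t = (\<Sum>i = (if t = 1 then 0 else 1)..l. monom (coeff p (l * (t - 1) + i)) i)"

lemma coeff_segment:
  "coeff (segment l p t) i = (if i \<le> l \<and> (t = 1 \<or> 1 \<le> i) then coeff p (l * (t - 1) + i) else 0)"
  by (simp add: segment_def coeff_sum)

lemma sum_segments:
  fixes p :: "'b::comm_semiring_1 poly"
  shows "(\<Sum>t\<le>k. monom 1 l ^ t * segment l p (Suc t)) = (\<Sum>i\<le>l * Suc k. monom (coeff p i) i)"
proof (induction k)
  case 0
  then show ?case by (simp add: segment_def atMost_atLeast0)
next
  case (Suc k)
  have "monom 1 l ^ Suc k * segment l p (Suc (Suc k))
      = (\<Sum>i = 1..l. monom (coeff p (l * Suc k + i)) (l * Suc k + i))"
    by (simp add: segment_def monom_power sum_distrib_left mult_monom ac_simps del: power_Suc)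
  also have "\<dots> = (\<Sum>i = 1 + l * Suc k..l + l * Suc k. monom (coeff p i) i)"
    by (subst sum.shift_bounds_cl_nat_ivl) (simp add: add.commute)
  finally have *: "monom 1 l ^ Suc k * segment l p (Suc (Suc k))
      = (\<Sum>i = Suc (l * Suc k)..l * Suc (Suc k). monom (coeff p i) i)"
    by (simp add: add.commute)
  have "{..l * Suc (Suc k)} = {..l * Suc k} \<union> {Suc (l * Suc k)..l * Suc (Suc k)}"
    by auto
  then have "(\<Sum>i\<le>l * Suc (Suc k). monom (coeff p i) i)
    = (\<Sum>i\<le>l * Suc k. monom (coeff p i) i)
      + (\<Sum>i = Suc (l * Suc k)..l * Suc (Suc k). monom (coeff p i) i)"
    by (simp only:) (intro sum.union_disjoint; auto)
  then show ?case
    by (simp only: sum.atMost_Suc Suc.IH *)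
qed

text \<open>
  The index pairs with \<open>i = 0\<close> or \<open>j = e\<close> form a path along the first row and down the last
  column, on which \<open>(h - i) + (e - j)\<close> takes each value from \<open>h + e\<close> down to \<open>0\<close> once.
\<close>
lemma sum_hook:
  fixes F :: "nat \<Rightarrow> 'b::comm_monoid_add"
  shows "(\<Sum>i\<le>h. \<Sum>j\<le>e. if i = 0 \<or> j = e then F ((h - i) + (e - j)) else 0) = (\<Sum>t\<le>h + e. F t)"
proof -
  define H where "H = {(i, j). i \<le> h \<and> j \<le> e \<and> (i = 0 \<or> j = e)}"
  have "(\<Sum>i\<le>h. \<Sum>j\<le>e. if i = 0 \<or> j = e then F ((h - i) + (e - j)) else 0)
      = (\<Sum>(i, j)\<in>{..h} \<times> {..e}. if i = 0 \<or> j = e then F ((h - i) + (e - j)) else 0)"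
    by (simp add: sum.cartesian_product)
  also have "\<dots> = (\<Sum>(i, j)\<in>H. F ((h - i) + (e - j)))"
    by (intro sum.mono_neutral_cong_right) (auto simp: H_def split: if_splits)
  also have "\<dots> = (\<Sum>t\<le>h + e. F t)"
    by (rule sum.reindex_bij_witness[of _
          "\<lambda>t. if t \<le> h then (h - t, e) else (0, e - (t - h))" "\<lambda>(i, j). (h - i) + (e - j)"])
       (auto simp: H_def split: if_splits)
  finally show ?thesis .
qed

lemma sum_segment_hook:
  fixes p :: "'b::comm_semiring_1 poly"
  assumes "\<And>i. i > l * Suc (h + e) \<Longrightarrow> coeff p i = 0"
  shows "(\<Sum>i\<le>h. \<Sum>j\<le>e. (monom 1 l ^ (h - i) * 1 ^ i) * (monom 1 l ^ (e - j) * 1 ^ j) *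
      (if i = 0 \<or> j = e then segment l p (Suc ((h - i) + (e - j))) else 0)) = p"
proof -
  have "(\<Sum>i\<le>h. \<Sum>j\<le>e. (monom 1 l ^ (h - i) * 1 ^ i) * (monom 1 l ^ (e - j) * 1 ^ j) *
      (if i = 0 \<or> j = e then segment l p (Suc ((h - i) + (e - j))) else 0))
    = (\<Sum>i\<le>h. \<Sum>j\<le>e. if i = 0 \<or> j = e then
        (\<lambda>t. monom 1 l ^ t * segment l p (Suc t)) ((h - i) + (e - j)) else 0)"
    by (intro sum.cong) (auto simp flip: power_add)
  also have "\<dots> = (\<Sum>i\<le>l * Suc (h + e). monom (coeff p i) i)"
    unfolding sum_hook[where F = "\<lambda>t. monom 1 l ^ t * segment l p (Suc t)"] by (rule sum_segments)
  also have "\<dots> = p"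
    using assms by (intro poly_eqI) (auto simp: coeff_sum not_le)
  finally show ?thesis .
qed

text \<open>
  This is the reversal of the preceding identity, term by term: the exponents
  \<open>(h - i) + (e - j)\<close> and \<open>i + j\<close> add up to \<open>h + e\<close>.
\<close>
lemma sum_rev_segment_hook:
  fixes p :: "'b::comm_semiring_1 poly"
  assumes p: "\<And>i. i > l * Suc (h + e) \<Longrightarrow> coeff p i = 0"
  shows "(\<Sum>i\<le>h. \<Sum>j\<le>e. (1 ^ (h - i) * monom 1 l ^ i) * (1 ^ (e - j) * monom 1 l ^ j) *
      rev_grade l (if i = 0 \<or> j = e then segment l p (Suc ((h - i) + (e - j))) else 0))
    = rev_grade (l * Suc (h + e)) p"
proof -
  define q where "q i j = (if i = 0 \<or> j = e then segment l p (Suc ((h - i) + (e - j))) else 0)" for i j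
  have q: "coeff (q i j) s = 0" if "s > l" for i j s
    using that by (auto simp: q_def coeff_segment)
  have "rev_grade (l * Suc (h + e)) p = rev_grade (l * Suc (h + e))
     (\<Sum>i\<le>h. \<Sum>j\<le>e. (monom 1 l ^ (h - i) * 1 ^ i) * (monom 1 l ^ (e - j) * 1 ^ j) * q i j)"
    using sum_segment_hook[OF p] by (simp add: q_def)
  also have "\<dots> = (\<Sum>i\<le>h. \<Sum>j\<le>e. rev_grade (l * Suc (h + e))
     ((monom 1 l ^ (h - i) * 1 ^ i) * (monom 1 l ^ (e - j) * 1 ^ j) * q i j))"
    by (simp only: rev_grade_sum)
  also have "\<dots> = (\<Sum>i\<le>h. \<Sum>j\<le>e.
     (1 ^ (h - i) * monom 1 l ^ i) * (1 ^ (e - j) * monom 1 l ^ j) * rev_grade l (q i j))"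
  proof (intro sum.cong refl)
    fix i j assume "i \<in> {..h}" "j \<in> {..e}"
    then have "(h - i) + (e - j) + (i + j) = h + e" by auto
    then have "l * Suc (h + e) = l * ((h - i) + (e - j)) + l * (i + j) + l"
      by (metis add.commute add_mult_distrib2 mult_Suc_right)
    then show "rev_grade (l * Suc (h + e))
        ((monom 1 l ^ (h - i) * 1 ^ i) * (monom 1 l ^ (e - j) * 1 ^ j) * q i j)
      = (1 ^ (h - i) * monom 1 l ^ i) * (1 ^ (e - j) * monom 1 l ^ j) * rev_grade l (q i j)"
      using rev_grade_monom_mult[of l "q i j" "l * ((h - i) + (e - j))" "l * (i + j)"] q
      by (simp only: monom_power mult_monom power_one mult_1_left mult_1_right
          add_mult_distrib2[of l, symmetric])
  qed
  finally show ?thesis by (simp add: q_def)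
qed

section \<open>Grade and degree of the pencil\<close>

lemma has_grade_iff:
  "has_grade d P \<longleftrightarrow> (\<forall>i<dim_row P. \<forall>j<dim_col P. \<forall>k>d. coeff (P $$ (i, j)) k = 0)"
  by (auto simp: has_grade_def mat_coeff_def mat_eq_iff)

lemma has_gradeD:
  assumes "has_grade d P" "i < dim_row P" "j < dim_col P" "k > d"
  shows "coeff (P $$ (i, j)) k = 0"
  using assms by (auto simp: has_grade_iff)

lemma has_degreeI:
  assumes "has_grade d P" "i < dim_row P" "j < dim_col P" "coeff (P $$ (i, j)) d \<noteq> 0"
  shows "has_degree d P"
  unfolding has_degree_def
proof
  show "mat_coeff P d \<noteq> 0\<^sub>m (dim_row P) (dim_col P)"
  proof
    assume "mat_coeff P d = 0\<^sub>m (dim_row P) (dim_col P)"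
    then have "mat_coeff P d $$ (i, j) = 0" using assms by simp
    then show False using assms by (simp add: mat_coeff_def)
  qed
qed (rule assms)

lemma has_grade_mat_rev: "has_grade d (mat_rev d P)"
  by (simp add: has_grade_iff mat_rev_eq coeff_rev_grade)

text \<open>
  The shape that a block Kronecker matrix polynomial shares with its reversal.
\<close>
definition bidiag_frame ::
  "nat \<Rightarrow> nat \<Rightarrow> nat \<Rightarrow> nat \<Rightarrow> 'b::{zero,one,times} \<Rightarrow> 'b \<Rightarrow> 'b mat \<Rightarrow> 'b mat" where
  "bidiag_frame h e m n a b A = four_block_mat A
     (kronecker (transpose_mat (bidiag h a b)) (1\<^sub>m m)) (kronecker (bidiag e a b) (1\<^sub>m n))
     (0\<^sub>m (e * n) (h * m))"

lemma bidiag_frame_carrier: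
  "A \<in> carrier_mat (Suc h * m) (Suc e * n) \<Longrightarrow>
   bidiag_frame h e m n a b A \<in> carrier_mat (Suc h * m + e * n) (Suc e * n + h * m)"
  unfolding bidiag_frame_def by (intro four_block_carrier_mat) auto

lemma index_bidiag_frame:
  fixes A :: "'b::semiring_1 mat"
  assumes A: "A \<in> carrier_mat (Suc h * m) (Suc e * n)"
    and "r < Suc h * m + e * n" "c < Suc e * n + h * m"
  shows "bidiag_frame h e m n a b A $$ (r, c) =
    (if r < Suc h * m then
       if c < Suc e * n then A $$ (r, c)
       else bidiag h a b $$ ((c - Suc e * n) div m, r div m)
         * (if r mod m = (c - Suc e * n) mod m then 1 else 0)
     else
       if c < Suc e * n then bidiag e a b $$ ((r - Suc h * m) div n, c div n)
         * (if (r - Suc h * m) mod n = c mod n then 1 else 0)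
       else 0)"
proof -
  have B: "kronecker (transpose_mat (bidiag h a b)) (1\<^sub>m m) $$ (r, c') =
      bidiag h a b $$ (c' div m, r div m) * (if r mod m = c' mod m then 1 else 0)"
    if "r < Suc h * m" "c' < h * m" for r c'
    using div_mod_less[OF that(1)] div_mod_less[OF that(2)] that
    by (subst index_kronecker[of _ "Suc h" h _ m m]) (auto simp: bidiag_def)
  have C: "kronecker (bidiag e a b) (1\<^sub>m n) $$ (r', c) =
      bidiag e a b $$ (r' div n, c div n) * (if r' mod n = c mod n then 1 else 0)"
    if "r' < e * n" "c < Suc e * n" for r' c
    using div_mod_less[OF that(1)] div_mod_less[OF that(2)] that
    by (subst index_kronecker[of _ e "Suc e" _ n n]) (auto simp: bidiag_def)
  have D: "dim_row A = Suc h * m" "dim_col A = Suc e * n" using A by auto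
  have "r - Suc h * m < e * n" if "\<not> r < Suc h * m" using that assms(2) by linarith
  moreover have "c - Suc e * n < h * m" if "\<not> c < Suc e * n" using that assms(3) by linarith
  ultimately show ?thesis
    using assms(2,3) B C unfolding bidiag_frame_def
    by (subst index_mat_four_block) (simp_all add: D del: mult_Suc)
qed

lemma bidiag_coeff_eq_0:
  assumes "\<And>i. i > l \<Longrightarrow> coeff a i = 0" "\<And>i. i > l \<Longrightarrow> coeff b i = 0"
    and "r < k" "c < Suc k" "i > l"
  shows "coeff (bidiag k a b $$ (r, c)) i = 0"
  using assms by (auto simp: bidiag_def)

text \<open>
  As \<open>h + e > 0\<close>, at least one off-diagonal block is present, and it contains both \<open>a\<close> and \<open>b\<close> as
  entries; one of them has degree exactly \<open>l\<close>, whatever \<open>A\<close> is.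
\<close>
lemma has_degree_bidiag_frame:
  fixes A :: "'b::comm_semiring_1 poly mat"
  assumes A: "A \<in> carrier_mat (Suc h * m) (Suc e * n)" "has_grade l A"
    and ab: "\<And>i. i > l \<Longrightarrow> coeff a i = 0" "\<And>i. i > l \<Longrightarrow> coeff b i = 0"
    and nz: "coeff a l \<noteq> 0 \<or> coeff b l \<noteq> 0" and pos: "0 < m" "0 < n" "0 < h + e"
  shows "has_degree l (bidiag_frame h e m n a b A)"
proof -
  let ?M = "bidiag_frame h e m n a b A"
  have dims: "dim_row ?M = Suc h * m + e * n" "dim_col ?M = Suc e * n + h * m"
    using bidiag_frame_carrier[OF A(1), of a b] by auto
  note index = index_bidiag_frame[OF A(1), of _ _ a b]
  have grade: "has_grade l ?M"
    unfolding has_grade_iff dims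
  proof (intro allI impI)
    fix r c k assume r: "r < Suc h * m + e * n" and c: "c < Suc e * n + h * m" and k: "k > l"
    have "coeff (A $$ (r, c)) k = 0" if "r < Suc h * m" "c < Suc e * n"
      using A that k by (intro has_gradeD[OF A(2)]) auto
    moreover have "coeff (bidiag h a b $$ ((c - Suc e * n) div m, r div m)) k = 0"
      if "r < Suc h * m" "\<not> c < Suc e * n"
      using ab k div_mod_less(1)[OF that(1)] div_mod_less(1)[of "c - Suc e * n" h m] that c
      by (intro bidiag_coeff_eq_0) (auto simp del: mult_Suc)
    moreover have "coeff (bidiag e a b $$ ((r - Suc h * m) div n, c div n)) k = 0"
      if "\<not> r < Suc h * m" "c < Suc e * n"
      using ab k div_mod_less(1)[OF that(2)] div_mod_less(1)[of "r - Suc h * m" e n] that r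
      by (intro bidiag_coeff_eq_0) (auto simp del: mult_Suc)
    ultimately show "coeff (?M $$ (r, c)) k = 0"
      unfolding index[OF r c] by (simp del: mult_Suc)
  qed
  show ?thesis
  proof (cases "e = 0")
    case False
    have "?M $$ (Suc h * m, 0) = a" "?M $$ (Suc h * m, n) = b"
      using False pos by (simp_all add: index bidiag_def)
    moreover have "Suc h * m < dim_row ?M" "0 < dim_col ?M" "n < dim_col ?M"
      using False pos by (auto simp: dims)
    ultimately show ?thesis
      using has_degreeI[OF grade, of "Suc h * m"] nz by metis
  next
    case True
    then have "?M $$ (0, Suc e * n) = a" "?M $$ (m, Suc e * n) = b"
      using pos index[of 0 "Suc e * n"] index[of m "Suc e * n"] by (simp_all add: bidiag_def)
    moreover have "Suc e * n < dim_col ?M" "0 < dim_row ?M" "m < dim_row ?M"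
      using True pos dims by simp_all
    ultimately show ?thesis
      using has_degreeI[OF grade, of _ "Suc e * n"] nz by metis
  qed
qed

lemma ell_ification_bidiag_frame:
  fixes x y :: "'a::field poly"
  assumes A: "A \<in> carrier_mat (Suc h * m) (Suc e * n)" "has_grade l A"
    and xy: "x = 1 \<or> y = 1" "\<And>i. i > l \<Longrightarrow> coeff x i = 0" "\<And>i. i > l \<Longrightarrow> coeff y i = 0"
      "coeff x l \<noteq> 0 \<or> coeff y l \<noteq> 0"
    and pos: "0 < l" "0 < m" "0 < n" "0 < h + e"
    and P: "P \<in> carrier_mat m n" "has_grade d P"
    and P_eq: "\<And>a b. a < m \<Longrightarrow> b < n \<Longrightarrow> (\<Sum>i\<le>h. \<Sum>j\<le>e.
         (x ^ (h - i) * y ^ i) * (x ^ (e - j) * y ^ j) * A $$ (i * m + a, j * n + b)) = P $$ (a, b)"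
  shows "ell_ification l (bidiag_frame h e m n (- y) x A) d P"
proof -
  let ?M = "bidiag_frame h e m n (- y) x A"
  have deg: "has_degree l ?M"
    using A xy pos by (intro has_degree_bidiag_frame) auto
  have "mat m n (\<lambda>(a, b). \<Sum>i\<le>h. \<Sum>j\<le>e.
         (x ^ (h - i) * y ^ i) * (x ^ (e - j) * y ^ j) * A $$ (i * m + a, j * n + b)) = P"
    using P by (intro eq_matI) (auto simp: P_eq)
  then have "unimodular_equivalent ?M
      (four_block_mat (1\<^sub>m (h * m + e * n)) (0\<^sub>m (h * m + e * n) n) (0\<^sub>m m (h * m + e * n)) P)"
    using block_bidiag_equivalent[OF xy(1) A(1)] by (simp only: bidiag_frame_def)
  then obtain U V where "U \<in> carrier_mat (dim_row ?M) (dim_row ?M)" "unimodular U"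
     "V \<in> carrier_mat (dim_col ?M) (dim_col ?M)" "unimodular V"
     "U * ?M * V = four_block_mat (1\<^sub>m (h * m + e * n)) (0\<^sub>m (h * m + e * n) n) (0\<^sub>m m (h * m + e * n)) P"
    unfolding unimodular_equivalent_def by blast
  then show ?thesis
    unfolding ell_ification_def using P pos deg by (metis carrier_matD)
qed

section \<open>The block Kronecker matrix polynomial\<close>

lemma map_kronecker_one:
  fixes f :: "'b::semiring_1 \<Rightarrow> 'c::semiring_1"
  assumes "f 0 = 0"
  shows "map_mat f (kronecker A (1\<^sub>m n)) = kronecker (map_mat f A) (1\<^sub>m n)"
  using assms by (intro eq_matI) (auto simp: kronecker_def div_mod_less dest!: div_mod_less(2))

lemma map_bidiag: "f 0 = 0 \<Longrightarrow> map_mat f (bidiag k a b) = bidiag k (f a) (f b)"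
  by (intro eq_matI) (auto simp: bidiag_def)

lemma subst_power_L_pencil: "subst_power l (L_pencil k) = bidiag k (- 1) (monom 1 l)"
  by (intro eq_matI) (auto simp: subst_power_def L_pencil_def bidiag_def pcompose_pCons pcompose_uminus
      pcompose_1)

lemma Sigma_mat_carrier:
  "P \<in> carrier_mat m n \<Longrightarrow> Sigma_mat l e h P \<in> carrier_mat (Suc h * m) (Suc e * n)"
  by (simp add: Sigma_mat_def Let_def)

text \<open>
  Both cases in the definition of the blocks give the same index \<open>t = 1 + (h - i) + (e - j)\<close>, so
  they agree in the corner where the block row and the block column meet.
\<close>
lemma index_Sigma_mat:
  fixes P :: "'b::comm_ring_1 poly mat"
  assumes P: "P \<in> carrier_mat m n" and r: "r < Suc h * m" and c: "c < Suc e * n"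
  shows "Sigma_mat l e h P $$ (r, c) = (if r div m = 0 \<or> c div n = e
    then segment l (P $$ (r mod m, c mod n)) (Suc ((h - r div m) + (e - c div n))) else 0)"
proof -
  note d = div_mod_less[OF r] div_mod_less[OF c]
  have B: "B_block l P t $$ (r mod m, c mod n) = segment l (P $$ (r mod m, c mod n)) t" for t
    using P d by (simp add: B_block_def segment_def mat_coeff_def)
  have "e + h + 1 - c div n = Suc (h + (e - c div n))" "h + 1 - r div m = Suc (h - r div m)"
    using d by auto
  then show ?thesis
    using P r c d by (simp add: Sigma_mat_def Let_def Sigma_block_def B)
qed

lemma has_grade_Sigma_mat:
  assumes "P \<in> carrier_mat m n"
  shows "has_grade l (Sigma_mat l e h P)"
  using Sigma_mat_carrier[OF assms, of l e h]
  by (auto simp: has_grade_iff index_Sigma_mat[OF assms] coeff_segment simp del: mult_Suc)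

lemma index_Sigma_mat_block:
  fixes P :: "'b::comm_ring_1 poly mat"
  assumes P: "P \<in> carrier_mat m n" and "i \<le> h" "j \<le> e" "a < m" "b < n"
  shows "Sigma_mat l e h P $$ (i * m + a, j * n + b) = (if i = 0 \<or> j = e
    then segment l (P $$ (a, b)) (Suc ((h - i) + (e - j))) else 0)"
  using assms mult_add_less_mult[of i "Suc h" a m] mult_add_less_mult[of j "Suc e" b n]
  by (subst index_Sigma_mat[OF P]) (auto simp del: mult_Suc)

lemma block_kronecker_mat_eq:
  assumes "P \<in> carrier_mat m n"
  shows "block_kronecker_mat l e h P = bidiag_frame h e m n (- 1) (monom 1 l) (Sigma_mat l e h P)"
  using assms
  by (simp add: block_kronecker_mat_def bidiag_frame_def Let_def subst_power_L_pencil)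

lemma mat_rev_bidiag_frame:
  fixes A :: "'b::comm_ring_1 poly mat"
  assumes A: "A \<in> carrier_mat (Suc h * m) (Suc e * n)"
  shows "mat_rev l (bidiag_frame h e m n a b A)
    = bidiag_frame h e m n (rev_grade l a) (rev_grade l b) (mat_rev l A)"
proof -
  have B: "kronecker (transpose_mat (bidiag h a b)) (1\<^sub>m m) \<in> carrier_mat (Suc h * m) (h * m)"
    and C: "kronecker (bidiag e a b) (1\<^sub>m n) \<in> carrier_mat (e * n) (Suc e * n)"
    by (intro kronecker_carrier; simp)+
  have "map_mat (rev_grade l) (0\<^sub>m (e * n) (h * m)) = (0\<^sub>m (e * n) (h * m) :: 'b poly mat)"
    by (intro eq_matI) auto
  moreover have "map_mat f (transpose_mat M) = transpose_mat (map_mat f M)"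
    for f :: "'b poly \<Rightarrow> 'b poly" and M by (intro eq_matI) auto
  ultimately show ?thesis
    unfolding bidiag_frame_def mat_rev_eq map_four_block_mat[OF A B C zero_carrier_mat]
    by (simp add: map_kronecker_one map_bidiag)
qed

text \<open>
  For the pencil itself the null vectors are those with \<open>x = \<lambda>\<^sup>l\<close>, \<open>y = 1\<close>; for its reversal
  those with \<open>x = 1\<close>, \<open>y = \<lambda>\<^sup>l\<close>.
\<close>
lemma strong_ell_ification_block_kronecker:
  fixes P :: "'a::field poly mat"
  assumes P: "P \<in> carrier_mat m n" "has_grade (l * Suc (h + e)) P"
    and pos: "0 < l" "0 < m" "0 < n" "0 < h + e"
  shows "strong_ell_ification l (block_kronecker_mat l e h P) (l * Suc (h + e)) P"
proof -
  let ?S = "Sigma_mat l e h P" and ?x = "monom 1 l :: 'a poly"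
  have S: "?S \<in> carrier_mat (Suc h * m) (Suc e * n)" "has_grade l ?S"
    using Sigma_mat_carrier[OF P(1)] has_grade_Sigma_mat[OF P(1)] by auto
  have Pz: "coeff (P $$ (a, b)) i = 0" if "a < m" "b < n" "i > l * Suc (h + e)" for a b i
    using has_gradeD[OF P(2), of a b i] P(1) that by auto
  have L: "ell_ification l (bidiag_frame h e m n (- 1) ?x ?S) (l * Suc (h + e)) P"
  proof (rule ell_ification_bidiag_frame)
    fix a b assume ab: "a < m" "b < n"
    have "(\<Sum>i\<le>h. \<Sum>j\<le>e. (?x ^ (h - i) * 1 ^ i) * (?x ^ (e - j) * 1 ^ j) *
        ?S $$ (i * m + a, j * n + b))
      = (\<Sum>i\<le>h. \<Sum>j\<le>e. (?x ^ (h - i) * 1 ^ i) * (?x ^ (e - j) * 1 ^ j) *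
        (if i = 0 \<or> j = e then segment l (P $$ (a, b)) (Suc ((h - i) + (e - j))) else 0))"
      by (intro sum.cong refl arg_cong2[where f = times] index_Sigma_mat_block[OF P(1)]) (use ab in auto)
    also have "\<dots> = P $$ (a, b)"
      by (rule sum_segment_hook[OF Pz[OF ab]])
    finally show "(\<Sum>i\<le>h. \<Sum>j\<le>e. (?x ^ (h - i) * 1 ^ i) * (?x ^ (e - j) * 1 ^ j) *
        ?S $$ (i * m + a, j * n + b)) = P $$ (a, b)" .
  qed (use P S pos in auto)
  have rx: "rev_grade l ?x = 1" "rev_grade l (- 1 :: 'a poly) = - ?x"
    by (auto simp: poly_eq_iff coeff_rev_grade)
  have S': "mat_rev l ?S \<in> carrier_mat (Suc h * m) (Suc e * n)"
    using S by (simp add: mat_rev_eq)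
  have P': "mat_rev (l * Suc (h + e)) P \<in> carrier_mat m n"
    using P by (simp add: mat_rev_eq)
  have R: "ell_ification l (bidiag_frame h e m n (- ?x) 1 (mat_rev l ?S)) (l * Suc (h + e))
      (mat_rev (l * Suc (h + e)) P)"
  proof (rule ell_ification_bidiag_frame)
    fix a b assume ab: "a < m" "b < n"
    have "(\<Sum>i\<le>h. \<Sum>j\<le>e. (1 ^ (h - i) * ?x ^ i) * (1 ^ (e - j) * ?x ^ j) *
        mat_rev l ?S $$ (i * m + a, j * n + b))
      = (\<Sum>i\<le>h. \<Sum>j\<le>e. (1 ^ (h - i) * ?x ^ i) * (1 ^ (e - j) * ?x ^ j) *
        rev_grade l (if i = 0 \<or> j = e then segment l (P $$ (a, b)) (Suc ((h - i) + (e - j))) else 0))"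
    proof (intro sum.cong refl arg_cong2[where f = times])
      fix i j assume "i \<in> {..h}" "j \<in> {..e}"
      then show "mat_rev l ?S $$ (i * m + a, j * n + b) = rev_grade l (if i = 0 \<or> j = e
         then segment l (P $$ (a, b)) (Suc ((h - i) + (e - j))) else 0)"
        using S ab mult_add_less_mult[of i "Suc h" a m] mult_add_less_mult[of j "Suc e" b n]
          index_Sigma_mat_block[OF P(1), of i h j e a b l]
        by (simp add: mat_rev_eq del: mult_Suc)
    qed
    also have "\<dots> = rev_grade (l * Suc (h + e)) (P $$ (a, b))"
      by (rule sum_rev_segment_hook[OF Pz[OF ab]])
    finally show "(\<Sum>i\<le>h. \<Sum>j\<le>e. (1 ^ (h - i) * ?x ^ i) * (1 ^ (e - j) * ?x ^ j) *
        mat_rev l ?S $$ (i * m + a, j * n + b)) = mat_rev (l * Suc (h + e)) P $$ (a, b)"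
      using P ab by (simp add: mat_rev_eq)
  qed (use P' S' pos in \<open>auto simp: has_grade_mat_rev\<close>)
  show ?thesis
    using L R by (simp add: strong_ell_ification_def block_kronecker_mat_eq[OF P(1)]
        mat_rev_bidiag_frame[OF S(1)] rx)
qed

theorem theorem5p8:
  fixes l k d eps eta m n :: nat
  assumes "m \<ge> 1" and "n \<ge> 1"
    and "l \<ge> 1" and "d = k * l" and "l < d"
    and "eps + eta + 1 = k"
  shows "companion_ell_ification l d m n
           (block_kronecker_mat l eps eta :: 'a::field poly mat \<Rightarrow> 'a poly mat)"
proof -
  let ?T = "block_kronecker_mat l eps eta :: 'a poly mat \<Rightarrow> 'a poly mat"
  have d: "d = l * Suc (eta + eps)"
    using assms by (simp add: ac_simps flip: assms(6))
  have pos: "0 < l" "0 < m" "0 < n" "0 < eta + eps"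
    using assms d by (auto intro!: Nat.gr0I)
  let ?p = "Suc eta * m + eps * n" and ?q = "Suc eps * n + eta * m"
  have T: "?T P \<in> carrier_mat ?p ?q" if "P \<in> carrier_mat m n" for P
    unfolding block_kronecker_mat_eq[OF that]
    by (rule bidiag_frame_carrier[OF Sigma_mat_carrier[OF that]])
  \<comment> \<open>every entry selects one coefficient, or does not depend on the argument\<close>
  have entry: "(\<exists>x. \<forall>P \<in> carrier_mat m n. has_grade d P \<longrightarrow> mat_coeff (?T P) i $$ (r, c) = x) \<or>
      (\<exists>x. \<exists>j\<le>d. \<exists>a<m. \<exists>b<n. \<forall>P \<in> carrier_mat m n. has_grade d P \<longrightarrow>
         mat_coeff (?T P) i $$ (r, c) = x * mat_coeff P j $$ (a, b))"
    if i: "i \<le> l" and r: "r < ?p" and c: "c < ?q" for i r c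
  proof (cases "r < Suc eta * m \<and> c < Suc eps * n")
    case False
    \<comment> \<open>outside the upper left block the constant can be read off at the zero polynomial\<close>
    have "mat_coeff (?T P) i $$ (r, c) = mat_coeff (?T (0\<^sub>m m n)) i $$ (r, c)"
      if P: "P \<in> carrier_mat m n" for P
    proof -
      have "?T P $$ (r, c) = ?T (0\<^sub>m m n) $$ (r, c)"
        using False
        unfolding block_kronecker_mat_eq[OF P] block_kronecker_mat_eq[OF zero_carrier_mat[of m n]]
          index_bidiag_frame[OF Sigma_mat_carrier[OF P] r c]
          index_bidiag_frame[OF Sigma_mat_carrier[OF zero_carrier_mat] r c]
        by (simp del: mult_Suc)
      then show ?thesis
        using T[OF P] T[OF zero_carrier_mat[of m n]] r c by (simp add: mat_coeff_def del: mult_Suc)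
    qed
    then show ?thesis by blast
  next
    case True
    note dm = div_mod_less[OF conjunct1[OF True]] div_mod_less[OF conjunct2[OF True]]
    define t where "t = (eta - r div m) + (eps - c div n)"
    have T_entry: "mat_coeff (?T P) i $$ (r, c) = (if r div m = 0 \<or> c div n = eps
        then coeff (segment l (P $$ (r mod m, c mod n)) (Suc t)) i else 0)"
      if P: "P \<in> carrier_mat m n" for P
    proof -
      have "mat_coeff (?T P) i $$ (r, c) = coeff (?T P $$ (r, c)) i"
        using T[OF P] r c by (simp add: mat_coeff_def del: mult_Suc)
      then show ?thesis
        using True index_Sigma_mat[OF P, of r eta c eps l]
        unfolding block_kronecker_mat_eq[OF P] index_bidiag_frame[OF Sigma_mat_carrier[OF P] r c]
        by (simp add: t_def del: mult_Suc)
    qed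
    show ?thesis
    proof (cases "(r div m = 0 \<or> c div n = eps) \<and> (t = 0 \<or> 1 \<le> i)")
      case False
      then have "mat_coeff (?T P) i $$ (r, c) = 0" if "P \<in> carrier_mat m n" for P
        unfolding T_entry[OF that] by (auto simp: coeff_segment)
      then show ?thesis by blast
    next
      case sel: True
      have "l * t + i \<le> l * (eta + eps) + l"
        using i by (intro add_mono mult_left_mono) (auto simp: t_def)
      then have "l * t + i \<le> d" by (simp add: d)
      moreover have "mat_coeff (?T P) i $$ (r, c) = 1 * mat_coeff P (l * t + i) $$ (r mod m, c mod n)"
        if "P \<in> carrier_mat m n" for P
        unfolding T_entry[OF that] using sel i that dm by (auto simp: coeff_segment mat_coeff_def)
      ultimately show ?thesis using dm by blast
    qed
  qed
  have strong: "strong_ell_ification l (?T P) d P" if "P \<in> carrier_mat m n" "has_grade d P" for P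
    using strong_ell_ification_block_kronecker[of P m n l eta eps] that pos by (simp only: d)
  show ?thesis
    unfolding companion_ell_ification_def
  proof (rule exI[of _ ?p], rule exI[of _ ?q], intro conjI ballI allI impI)
    show "?T P \<in> carrier_mat ?p ?q" "strong_ell_ification l (?T P) d P"
      if "P \<in> carrier_mat m n" "has_grade d P" for P
      using T strong that by blast+
  qed (rule entry)
qed

end
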